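(* Let $\mathfrak{H}$ be a $d$-degenerate edge-ordered graph on $n'$ vertices and let $\mathfrak{G}$ be a bipartite edge-ordered graph with $m$ edges and with both parts containing $n$ vertices. Let $t = 3n^{10}\, m!$. If $d \leq n$ and $n' \leq t^{d+1}$, then \[\overline{R}_e(\mathfrak{H},\mathfrak{G}) \leq (n')^2 t^{d+1}.\]
   Context: All graphs are finite and simple; $d, n, n'$ are positive integers. An edge-ordered graph $\mathfrak{G}=(G,\prec)$ consists of a graph $G=(V,E)$ and a linear ordering $\prec$ of its edge set $E$; $\mathfrak{G}$ (or $\prec$) is also called an edge-ordering of $G$. An edge-ordered graph $(G,\prec_1)$ is an edge-ordered subgraph of $(H,\prec_2)$ if $G$ is a (not necessarily induced) subgraph of $H$ and $\prec_1$ is a suborder of $\prec_2$. Two edge-ordered graphs are isomorphic if there is a graph isomorphism between them that preserves the edge-orderings; a copy of $\mathfrak{G}$ in an edge-ordered graph is an edge-ordered subgraph isomorphic to $\mathfrak{G}$. A graph is $d$-degenerate if every subgraph of it has a vertex of degree at most $d$; an edge-ordered graph is $d$-degenerate (respectively bipartite) if its underlying graph is. For edge-ordered graphs $\mathfrak{H}$ and $\mathfrak{G}$, the non-diagonal edge-ordered Ramsey number $\overline{R}_e(\mathfrak{H},\mathfrak{G})$ is the minimum positive integer $N$ such that there exists an edge-ordering $\mathfrak{K}_N$ of the complete graph $K_N$ on $N$ vertices such that every 2-coloring of the edges of $\mathfrak{K}_N$ with colors red and blue contains a red copy of $\mathfrak{H}$ (all edges red) or a blue copy of $\mathfrak{G}$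 (all edges blue) as an edge-ordered subgraph of $\mathfrak{K}_N$. *)

theory Defs
  imports Main "HOL-Library.Extended_Nat"
begin

definition simple_graph :: "'a set \<Rightarrow> 'a set set \<Rightarrow> bool" where
  "simple_graph V E \<longleftrightarrow> finite V \<and> (\<forall>e\<in>E. e \<subseteq> V \<and> card e = 2)"

definition subgraph :: "'a set \<Rightarrow> 'a set set \<Rightarrow> 'a set \<Rightarrow> 'a set set \<Rightarrow> bool" where
  "subgraph W F V E \<longleftrightarrow> simple_graph W F \<and> simple_graph V E \<and> W \<subseteq> V \<and> F \<subseteq> E"

definition degree :: "'a set set \<Rightarrow> 'a \<Rightarrow> nat" where
  "degree E v = card {e \<in> E. v \<in> e}"

text \<open>The subgraph without vertices has to be excluded: it has no vertex of small degree.\<close>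

definition degenerate :: "nat \<Rightarrow> 'a set \<Rightarrow> 'a set set \<Rightarrow> bool" where
  "degenerate d V E \<longleftrightarrow>
     (\<forall>W F. subgraph W F V E \<and> W \<noteq> {} \<longrightarrow> (\<exists>v\<in>W. degree F v \<le> d))"

definition bipartition :: "'a set \<Rightarrow> 'a set \<Rightarrow> 'a set \<Rightarrow> 'a set set \<Rightarrow> bool" where
  "bipartition A B V E \<longleftrightarrow>
     A \<union> B = V \<and> A \<inter> B = {} \<and> (\<forall>e\<in>E. \<exists>a\<in>A. \<exists>b\<in>B. e = {a, b})"

definition graph_iso ::
  "('a \<Rightarrow> 'b) \<Rightarrow> 'a set \<Rightarrow> 'a set set \<Rightarrow> 'b set \<Rightarrow> 'b set set \<Rightarrow> bool" where
  "graph_iso f V E V' E' \<longleftrightarrow>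
     bij_betw f V V' \<and> (\<forall>u\<in>V. \<forall>v\<in>V. {u, v} \<in> E \<longleftrightarrow> {f u, f v} \<in> E')"

record 'a edge_ordered_graph =
  verts :: "'a set"
  edges :: "'a set set"
  edge_order :: "('a set \<times> 'a set) set"

text \<open>The ordering of the edges is given by its reflexive version.\<close>

definition edge_ordered_graph :: "'a edge_ordered_graph \<Rightarrow> bool" where
  "edge_ordered_graph G \<longleftrightarrow>
     simple_graph (verts G) (edges G) \<and> linear_order_on (edges G) (edge_order G)"

definition edge_ordered_subgraph ::
  "'a edge_ordered_graph \<Rightarrow> 'a edge_ordered_graph \<Rightarrow> bool" where
  "edge_ordered_subgraph G H \<longleftrightarrow>
     edge_ordered_graph G \<and> edge_ordered_graph H \<and>
     subgraph (verts G) (edges G) (verts H) (edges H) \<and>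
     edge_order G = Restr (edge_order H) (edges G)"

definition edge_ordered_iso ::
  "'a edge_ordered_graph \<Rightarrow> 'b edge_ordered_graph \<Rightarrow> bool" where
  "edge_ordered_iso G H \<longleftrightarrow>
     (\<exists>f. graph_iso f (verts G) (edges G) (verts H) (edges H) \<and>
          (\<forall>e\<in>edges G. \<forall>e'\<in>edges G.
             (e, e') \<in> edge_order G \<longleftrightarrow> (f ` e, f ` e') \<in> edge_order H))"

definition copy_in ::
  "'b edge_ordered_graph \<Rightarrow> 'a edge_ordered_graph \<Rightarrow> 'b edge_ordered_graph \<Rightarrow> bool" where
  "copy_in C G K \<longleftrightarrow> edge_ordered_subgraph C K \<and> edge_ordered_iso G C"

definition edge_ordering_of_complete :: "nat \<Rightarrow> nat edge_ordered_graph \<Rightarrow> bool" where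
  "edge_ordering_of_complete N K \<longleftrightarrow>
     edge_ordered_graph K \<and> verts K = {..<N} \<and> edges K = {e. e \<subseteq> {..<N} \<and> card e = 2}"

datatype colour = Red | Blue

text \<open>
  A colouring is a total function on sets of vertices, of which only the values on the edges matter.
\<close>

definition edge_ramsey_arrows ::
  "'c edge_ordered_graph \<Rightarrow> 'a edge_ordered_graph \<Rightarrow> 'b edge_ordered_graph \<Rightarrow> bool" where
  "edge_ramsey_arrows K H G \<longleftrightarrow>
     (\<forall>c :: 'c set \<Rightarrow> colour.
        (\<exists>C. copy_in C H K \<and> (\<forall>e\<in>edges C. c e = Red)) \<or>
        (\<exists>C. copy_in C G K \<and> (\<forall>e\<in>edges C. c e = Blue)))"

text \<open>
  The minimum is taken in \<^typ>\<open>enat\<close>, where it is \<open>\<infinity>\<close> if there is no such \<open>N\<close>.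
  An upper bound by a natural number thus includes that the minimum exists.
\<close>

definition edge_ordered_ramsey ::
  "'a edge_ordered_graph \<Rightarrow> 'b edge_ordered_graph \<Rightarrow> enat" where
  "edge_ordered_ramsey H G =
     (INF N \<in> {N. N > 0 \<and> (\<exists>K. edge_ordering_of_complete N K \<and> edge_ramsey_arrows K H G)}. enat N)"

end

theory Submission
  imports Defs Complex_Main "HOL-Library.FuncSet" "HOL-Library.Product_Lexorder"
begin

text \<open>
  Split the vertices of the complete graph into \<open>n'\<close> blocks of size \<open>M = n' t\<^sup>d\<^sup>+\<^sup>1\<close>, one for each vertex of
  \<open>H\<close>. Edges between two blocks are ordered first by the rank in \<open>H\<close> of the edge joining the two
  corresponding vertices, so that every transversal of the blocks carries the edge-ordering of \<open>H\<close>.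
  Ties are broken by one labelling \<open>f\<close> of the grid \<open>M \<times> M\<close>, used for all pairs of blocks, such that every
  \<open>t \<times> t\<close> subgrid contains a copy of \<open>G\<close> with increasing labels. A random labelling has this property:
  a subgrid contains \<open>(t / n)\<^sup>2\<close> disjoint \<open>n \<times> n\<close> cells, each of which independently carries an ordered
  copy of \<open>G\<close> with probability at least \<open>1 / (2 m!)\<close>, and there are at most \<open>M\<^sup>2\<^sup>t\<close> subgrids.

  Given a colouring, embed \<open>H\<close> in red greedily in a degeneracy order, keeping for a vertex with \<open>k\<close> embedded
  neighbours at least \<open>n' t\<^sup>d\<^sup>+\<^sup>1\<^sup>-\<^sup>k\<close> candidates. If no candidate can be chosen, then by pigeonhole
  \<open>t\<close> of them have few red neighbours among the candidates of one later vertex. This gives an entirely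
  blue \<open>t \<times> t\<close> subgrid, hence a blue copy of \<open>G\<close>.
\<close>

section \<open>Ranks in finite linear orders\<close>

text \<open>The rank of an element is the number of its strict predecessors. Ranks replace the
  abstract edge orders of \<open>H\<close> and \<open>G\<close> by comparisons of natural
  numbers.\<close>

lemma linear_order_rank:
  assumes "finite A" "linear_order_on A r"
  obtains rk where "bij_betw rk A {..<card A}"
    and "\<And>x y. x \<in> A \<Longrightarrow> y \<in> A \<Longrightarrow> x \<noteq> y \<Longrightarrow> (x, y) \<in> r \<Longrightarrow> rk x < rk y"
proof -
  define rk where "rk x = card {y \<in> A. y \<noteq> x \<and> (y, x) \<in> r}" for x
  have tr: "trans r" and an: "antisym r" and tot: "total_on A r"
    using assms(2) by (auto simp: linear_order_on_def partial_order_on_def preorder_on_def)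
  have rk_less: "rk x < rk y" if "x \<in> A" "y \<in> A" "x \<noteq> y" "(x, y) \<in> r" for x y
  proof -
    have "{z \<in> A. z \<noteq> x \<and> (z, x) \<in> r} \<subseteq> {z \<in> A. z \<noteq> y \<and> (z, y) \<in> r}"
      using that tr an unfolding trans_def antisym_def by blast
    moreover have "x \<in> {z \<in> A. z \<noteq> y \<and> (z, y) \<in> r} - {z \<in> A. z \<noteq> x \<and> (z, x) \<in> r}"
      using that by auto
    ultimately show ?thesis
      unfolding rk_def by (intro psubset_card_mono) (use assms(1) in auto)
  qed
  have inj: "inj_on rk A"
    using rk_less tot unfolding inj_on_def total_on_def by (metis less_irrefl)
  have "rk x < card A" if "x \<in> A" for x
    unfolding rk_def by (rule psubset_card_mono) (use assms(1) that in auto)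
  then have "rk ` A = {..<card A}"
    by (intro card_subset_eq) (auto simp: card_image[OF inj])
  with inj rk_less show thesis
    by (intro that) (auto simp: bij_betw_def)
qed

lemma linear_order_on_subset:
  "linear_order_on A r \<Longrightarrow> B \<subseteq> A \<Longrightarrow> linear_order_on B (Restr r B)"
  unfolding linear_order_on_def partial_order_on_def preorder_on_def refl_on_def total_on_def
    antisym_def trans_def
  by (intro conjI) blast+

section \<open>Random labellings of the grid, treated by counting\<close>

text \<open>This is the product rule for independent events. By \<open>local\<close>, the event
  \<open>P i\<close> depends only on the labels on \<open>T i\<close>, and these sets are disjoint.
  Splitting a labelling into its restrictions to \<open>T i\<close> and to the rest of
  \<open>S\<close> is injective, so each index contributes one factor
  \<open>\<beta>\<close>.\<close>

lemma card_PiE_avoid_le: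
  fixes T :: "'i \<Rightarrow> 'e set" and P :: "'i \<Rightarrow> ('e \<Rightarrow> 'l) \<Rightarrow> bool" and \<beta> :: real
  assumes "finite I" "finite S" "finite L" "0 \<le> \<beta>"
    and "\<And>i. i \<in> I \<Longrightarrow> T i \<subseteq> S"
    and "\<And>i j. i \<in> I \<Longrightarrow> j \<in> I \<Longrightarrow> i \<noteq> j \<Longrightarrow> T i \<inter> T j = {}"
    and local: "\<And>i f g. i \<in> I \<Longrightarrow> (\<And>x. x \<in> T i \<Longrightarrow> f x = g x) \<Longrightarrow> P i f \<longleftrightarrow> P i g"
    and bound: "\<And>i. i \<in> I \<Longrightarrow>
      real (card {f \<in> T i \<rightarrow>\<^sub>E L. \<not> P i f}) \<le> \<beta> * real (card L) ^ card (T i)"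
  shows "real (card {f \<in> S \<rightarrow>\<^sub>E L. \<forall>i\<in>I. \<not> P i f}) \<le> \<beta> ^ card I * real (card L) ^ card S"
  using assms
proof (induction I arbitrary: S rule: finite_induct)
  case empty
  then show ?case by (simp add: card_PiE)
next
  case (insert i I)
  let ?U = "S - T i"
  let ?X = "{f \<in> S \<rightarrow>\<^sub>E L. \<forall>i\<in>insert i I. \<not> P i f}"
  let ?Y = "{f \<in> ?U \<rightarrow>\<^sub>E L. \<forall>i\<in>I. \<not> P i f}"
  let ?Z = "{f \<in> T i \<rightarrow>\<^sub>E L. \<not> P i f}"
  let ?h = "\<lambda>f. (restrict f ?U, restrict f (T i))"
  have Ti: "T i \<subseteq> S" "finite (T i)"
    using insert.prems(1) insert.prems(4)[of i] finite_subset by auto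
  have TU: "T j \<subseteq> ?U" if "j \<in> I" for j
    using insert.prems(4)[of j] insert.prems(5)[of i j] insert.hyps that by auto
  have IH: "real (card ?Y) \<le> \<beta> ^ card I * real (card L) ^ card ?U"
  proof (rule insert.IH)
    show "finite ?U"
      using insert.prems(1) by simp
    show "P j f \<longleftrightarrow> P j g" if "j \<in> I" "\<And>x. x \<in> T j \<Longrightarrow> f x = g x" for j f g
      using that by (intro insert.prems(6)) auto
  qed (use insert.prems(2,3,4,5,7) TU in auto)
  have fin: "finite ?Y" "finite ?Z"
    using finite_PiE[of ?U "\<lambda>_. L"] finite_PiE[of "T i" "\<lambda>_. L"] insert.prems(1,2) Ti
    by (auto intro: rev_finite_subset)
  have "inj_on ?h ?X"
  proof (rule inj_onI)
    fix f g assume f: "f \<in> ?X" and g: "g \<in> ?X" and "?h f = ?h g"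
    then have "restrict f ?U x = restrict g ?U x" "restrict f (T i) x = restrict g (T i) x" for x
      by simp_all
    then have "f x = g x" if "x \<in> S" for x
      using that by (metis DiffI restrict_apply')
    then show "f = g"
      using f g by (intro PiE_ext[of f S "\<lambda>_. L" g]) auto
  qed
  moreover have "?h ` ?X \<subseteq> ?Y \<times> ?Z"
  proof clarify
    fix f assume f: "f \<in> S \<rightarrow>\<^sub>E L" "\<forall>i\<in>insert i I. \<not> P i f"
    have "\<not> P j (restrict f ?U)" if j: "j \<in> I" for j
    proof -
      have "P j f \<longleftrightarrow> P j (restrict f ?U)"
        using TU[OF j] j by (intro insert.prems(6)) auto
      then show ?thesis
        using f(2) j by blast
    qed
    moreover have "\<not> P i (restrict f (T i))"
    proof -
      have "P i f \<longleftrightarrow> P i (restrict f (T i))"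
        by (intro insert.prems(6)) auto
      then show ?thesis
        using f(2) by blast
    qed
    ultimately show "restrict f ?U \<in> ?Y \<and> restrict f (T i) \<in> ?Z"
      using f Ti by (auto simp: PiE_iff)
  qed
  ultimately have "card ?X \<le> card (?Y \<times> ?Z)"
    using fin by (intro card_inj_on_le) auto
  then have "real (card ?X) \<le> real (card ?Y) * real (card ?Z)"
    by (simp only: card_cartesian_product of_nat_le_iff flip: of_nat_mult)
  also have "\<dots> \<le> (\<beta> ^ card I * real (card L) ^ card ?U) * (\<beta> * real (card L) ^ card (T i))"
    using IH insert.prems(7)[of i] insert.prems(3) by (intro mult_mono) auto
  also have "\<dots> = \<beta> ^ card (insert i I) * real (card L) ^ (card ?U + card (T i))"
    using insert.hyps by (simp add: power_add)
  also have "card ?U + card (T i) = card S"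
    using Ti insert.prems(1) by (simp add: card_Diff_subset card_mono)
  finally show ?case .
qed

text \<open>Every set of \<open>m\<close> labels is the image of an increasing labelling, obtained
  by listing the set in increasing order along \<open>c\<close>. Taking images therefore reaches all
  \<open>m\<close>-element sets of labels.\<close>

lemma choose_le_card_increasing_labellings:
  assumes c: "bij_betw c {..<m} T"
  shows "Q choose m \<le> card {f \<in> T \<rightarrow>\<^sub>E {..<Q}. \<forall>l' < m. \<forall>l<l'. f (c l) < f (c l')}"
    (is "_ \<le> card ?F")
proof -
  have "finite T"
    using c bij_betw_finite by blast
  have "{X. X \<subseteq> {..<Q} \<and> card X = m} \<subseteq> (\<lambda>f. f ` T) ` ?F"
  proof clarify
    fix X assume X: "X \<subseteq> {..<Q}" "m = card X"
    define xs where "xs = sorted_list_of_set X"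
    have fX: "finite X"
      using X finite_subset by auto
    have xs: "sorted_wrt (<) xs" "set xs = X" "length xs = m"
      using fX X by (auto simp: xs_def)
    define f where "f = restrict (\<lambda>e. xs ! inv_into {..<m} c e) T"
    have fc: "f (c l) = xs ! l" if "l < m" for l
      using c that unfolding f_def bij_betw_def by (auto simp: inv_into_f_f)
    have im: "f ` T = X"
    proof -
      have "f ` T = (\<lambda>l. f (c l)) ` {..<m}"
        using c by (auto simp: bij_betw_def)
      also have "\<dots> = (\<lambda>l. xs ! l) ` {..<m}"
        using fc by auto
      also have "\<dots> = X"
        using xs by (auto simp: set_conv_nth)
      finally show ?thesis .
    qed
    moreover have "f \<in> T \<rightarrow>\<^sub>E {..<Q}"
      using im X by (auto simp: f_def PiE_iff)
    moreover have "\<forall>l' < card X. \<forall>l<l'. f (c l) < f (c l')"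
      using fc xs X(2) by (auto simp: sorted_wrt_iff_nth_less)
    ultimately show "X \<in> (\<lambda>f. f ` T) ` {f \<in> T \<rightarrow>\<^sub>E {..<Q}. \<forall>l'<card X. \<forall>l<l'. f (c l) < f (c l')}"
      by blast
  qed
  moreover have "finite ?F"
    using \<open>finite T\<close> by (auto intro!: finite_PiE)
  ultimately have "card {X. X \<subseteq> {..<Q} \<and> card X = m} \<le> card ?F"
    by (rule surj_card_le[rotated])
  then show ?thesis
    by (simp add: n_subsets)
qed

text \<open>With \<open>2 m\<^sup>2 + 1\<close> labels at least half of the labellings of \<open>m\<close> cells are injective.\<close>

lemma choose_ge_power_div_fact:
  fixes m :: nat
  defines "Q \<equiv> 2 * m\<^sup>2 + 1"
  shows "real Q ^ m \<le> 2 * fact m * real (Q choose m)"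
proof -
  have mQ: "m \<le> Q"
    unfolding Q_def by (metis le_add1 le_square mult_2 order_trans power2_eq_square trans_le_add1)
  have Q0: "real Q > 0"
    unfolding Q_def by (simp only: of_nat_0_less_iff)
  \<comment> \<open>Since \<open>m ^ 2 / Q\<close> is below one half, Bernoulli's inequality gives
    that \<open>(1 - m / Q) ^ m\<close> is at least one half. The rest compares
    \<open>(Q - m) ^ m\<close> with the falling factorial of \<open>Q\<close>.\<close>
  have "1 / 2 \<le> 1 - real m * (real m / real Q)"
    using Q0 by (simp add: Q_def field_simps power2_eq_square)
  also have "\<dots> \<le> (1 - real m / real Q) ^ m"
    using Bernoulli_inequality[of "- (real m / real Q)" m] mQ Q0 by (simp add: field_simps)
  finally have "real Q ^ m \<le> 2 * (real Q ^ m * (1 - real m / real Q) ^ m)"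
    using Q0 by (simp add: field_simps)
  also have "real Q ^ m * (1 - real m / real Q) ^ m = (real Q - real m) ^ m"
    using Q0 by (simp add: power_mult_distrib[symmetric] field_simps)
  also have "\<dots> \<le> (\<Prod>i=0..<m. real (Q - i))"
  proof -
    have "(\<Prod>i=0..<m. real Q - real m) \<le> (\<Prod>i=0..<m. real (Q - i))"
      using mQ by (intro prod_mono) auto
    then show ?thesis
      by simp
  qed
  also have "\<dots> = fact m * real (Q choose m)"
    using mQ by (simp add: binomial_altdef_of_nat prod_dividef fact_prod_rev)
  finally show ?thesis
    by simp
qed

text \<open>The complementary count: the increasing labellings make up a fraction of at least
  \<open>(Q choose m) / Q ^ m\<close>, hence at least \<open>1 / (2 * fact m)\<close>. The bound is
  the failure probability of a single cell.\<close>

lemma card_not_increasing_labellings_le: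
  fixes c :: "nat \<Rightarrow> 'e" and m :: nat
  defines "Q \<equiv> 2 * m\<^sup>2 + 1"
  assumes c: "bij_betw c {..<m} T"
  shows "real (card {f \<in> T \<rightarrow>\<^sub>E {..<Q}. \<not> (\<forall>l' < m. \<forall>l<l'. f (c l) < f (c l'))})
    \<le> (1 - 1 / (2 * fact m)) * real Q ^ card T"
proof -
  let ?P = "\<lambda>f. \<forall>l' < m. \<forall>l<l'. f (c l) < f (c l')"
  let ?A = "{f \<in> T \<rightarrow>\<^sub>E {..<Q}. ?P f}" and ?B = "{f \<in> T \<rightarrow>\<^sub>E {..<Q}. \<not> ?P f}"
  have T: "finite T" "card T = m"
    using c bij_betw_finite bij_betw_same_card by (blast, force)
  have fin: "finite (T \<rightarrow>\<^sub>E {..<Q})"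
    using T by (auto intro!: finite_PiE)
  have "card (T \<rightarrow>\<^sub>E {..<Q}) = card ?A + card ?B"
    by (subst card_Un_disjoint[symmetric]) (use fin in \<open>auto intro: arg_cong[where f = card]\<close>)
  then have "real Q ^ m = real (card ?A) + real (card ?B)"
    using T by (simp add: card_PiE flip: of_nat_add of_nat_power)
  moreover have "real Q ^ m \<le> 2 * fact m * real (Q choose m)"
    unfolding Q_def by (rule choose_ge_power_div_fact)
  then have "real Q ^ m / (2 * fact m) \<le> real (Q choose m)"
    by (simp add: field_simps)
  moreover have "real (Q choose m) \<le> real (card ?A)"
    using choose_le_card_increasing_labellings[OF c] by simp
  moreover have "(1 - 1 / (2 * fact m)) * real Q ^ card T = real Q ^ m - real Q ^ m / (2 * fact m)"
    by (simp add: T algebra_simps)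
  ultimately show ?thesis
    by linarith
qed

text \<open>
  Here \<open>M\<^sup>2\<^sup>t\<close> counts pairs of enumerations of the rows and columns of a \<open>t \<times> t\<close> subgrid, and
  \<open>3 n\<^sup>9 m! = t / n\<close>.
\<close>

lemma union_bound_estimate:
  fixes n m d M t :: nat
  assumes "2 \<le> n" "m \<le> n\<^sup>2" "d \<le> n" and t: "t = 3 * n ^ 10 * fact m" and M: "M \<le> t ^ (2 * (d + 1))"
  shows "real M ^ (2 * t) * (1 - 1 / (2 * fact m)) ^ (3 * n ^ 9 * fact m)\<^sup>2 < 1"
proof -
  let ?q = "fact m :: real"
  have q1: "1 \<le> ?q"
    by simp
  have "0 < t"
    using assms(1) by (simp add: t)
  then have t1: "1 \<le> real t"
    by simp
  have n2: "2 \<le> real n"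
    using assms(1) by simp
  have lnn: "ln (real n) \<le> real n - 1"
    using n2 by (intro ln_le_minus_one) auto
  \<comment> \<open>From \<open>m \<le> n\<^sup>2\<close> follows that \<open>fact m\<close> is at
    most \<open>n ^ (2 * n\<^sup>2)\<close>; then \<open>ln n \<le> n - 1\<close> makes the bound
    polynomial in \<open>n\<close>.\<close>
  have lnq: "ln ?q \<le> 2 * real n ^ 2 * (real n - 1)"
  proof -
    have "?q \<le> real (m ^ m)"
      by (rule fact_le_power)
    also have "m ^ m \<le> (n\<^sup>2) ^ m"
      using assms by (intro power_mono) auto
    also have "\<dots> \<le> (n\<^sup>2) ^ (n\<^sup>2)"
      using assms by (intro power_increasing) auto
    also have "\<dots> = n ^ (2 * n\<^sup>2)"
      by (simp add: power_mult)
    finally have "?q \<le> real n ^ (2 * n\<^sup>2)"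
      by simp
    then have "ln ?q \<le> ln (real n ^ (2 * n\<^sup>2))"
      using q1 n2 by (subst ln_le_cancel_iff) auto
    also have "\<dots> = 2 * real n ^ 2 * ln (real n)"
      using n2 by (simp add: ln_realpow)
    also have "\<dots> \<le> 2 * real n ^ 2 * (real n - 1)"
      using lnn by (intro mult_left_mono) auto
    finally show ?thesis .
  qed
  have "ln (real t) = ln 3 + 10 * ln (real n) + ln ?q"
    using n2 by (simp add: t ln_mult ln_realpow)
  also have "\<dots> \<le> 2 + 10 * (real n - 1) + 2 * real n ^ 2 * (real n - 1)"
    using lnn lnq ln_le_minus_one[of "3::real"] by auto
  finally have lnt: "4 * ln (real t) \<le> 8 * real n ^ 3 - 8 * real n ^ 2 + 40 * real n - 32"
    by (simp add: algebra_simps power3_eq_cube power2_eq_square)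
  have n_sq: "4 \<le> real n ^ 2"
    using power_mono[OF n2, of 2] by simp
  have "8 * real n ^ 3 - 8 * real n ^ 2 + 40 * real n - 32 < 16 * real n ^ 3"
  proof -
    have "4 * real n \<le> real n ^ 3" "2 * real n \<le> real n ^ 2"
      using n2 n_sq mult_right_mono[OF n_sq, of "real n"] by (auto simp: power3_eq_cube power2_eq_square)
    then show ?thesis
      by simp
  qed
  also have "\<dots> \<le> real n ^ 7"
  proof -
    have "16 \<le> real n ^ 4"
      using power_mono[OF n2, of 4] by simp
    then have "16 * real n ^ 3 \<le> real n ^ 4 * real n ^ 3"
      by (intro mult_right_mono) auto
    then show ?thesis
      by (simp flip: power_add)
  qed
  finally have lnt': "4 * ln (real t) < real n ^ 7"
    using lnt by linarith
  \<comment> \<open>The logarithms of the two factors are compared. As \<open>d \<le> n\<close> and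
    \<open>2 \<le> n\<close>, the factor \<open>4 * (d + 1)\<close> is at most \<open>6 * n\<close>.
    Bounding \<open>ln t\<close> by \<open>n ^ 7 / 4\<close> then yields
    \<open>9 / 2 * n ^ 18 * fact m\<close>, which is exactly the number of cells divided by
    \<open>2 * fact m\<close>.\<close>
  have "real (4 * (d + 1) * t) * ln (real t) \<le> (6 * real n) * real t * ln (real t)"
    using assms t1 by (intro mult_right_mono) auto
  also have "\<dots> = 18 * real n ^ 11 * ?q * ln (real t)"
    by (simp add: t eval_nat_numeral)
  also have "\<dots> < 18 * real n ^ 11 * ?q * (real n ^ 7 / 4)"
    using lnt' n2 q1 by (intro mult_strict_left_mono) auto
  also have "\<dots> = 9 / 2 * real n ^ 18 * ?q"
    by (simp add: eval_nat_numeral)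
  also have "\<dots> = real ((3 * n ^ 9 * fact m)\<^sup>2) * (1 / (2 * ?q))"
    using q1 by (simp add: power_mult_distrib power2_eq_square field_simps)
  finally have key: "real (4 * (d + 1) * t) * ln (real t)
    < real ((3 * n ^ 9 * fact m)\<^sup>2) * (1 / (2 * ?q))" (is "?a < real ?K * ?b") .
  have "real M ^ (2 * t) \<le> (real t ^ (2 * (d + 1))) ^ (2 * t)"
    using of_nat_mono[OF M, where 'a = real] by (intro power_mono) (simp_all only: of_nat_power)
  also have "\<dots> = real t ^ (4 * (d + 1) * t)"
    unfolding power_mult[symmetric] by (intro arg_cong[where f = "(^) (real t)"]) (simp add: algebra_simps)
  also have "\<dots> = exp ?a"
    using t1 by (subst exp_of_nat_mult) simp
  finally have 1: "real M ^ (2 * t) \<le> exp ?a" .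
  have "1 \<le> 2 * ?q"
    using q1 by linarith
  then have b1: "0 \<le> 1 - ?b"
    by simp
  have "1 - ?b \<le> exp (- ?b)"
    using exp_ge_add_one_self[of "- ?b"] by simp
  then have "(1 - ?b) ^ ?K \<le> exp (- ?b) ^ ?K"
    using b1 by (intro power_mono)
  also have "\<dots> = exp (- (real ?K * ?b))"
    by (subst exp_of_nat_mult[symmetric]) simp
  finally have "real M ^ (2 * t) * (1 - ?b) ^ ?K \<le> exp ?a * exp (- (real ?K * ?b))"
    using 1 b1 by (intro mult_mono) auto
  also have "\<dots> < 1"
    using key by (simp flip: exp_add)
  finally show ?thesis .
qed

text \<open>\<open>p l\<close> stands for the position of the \<open>l\<close>-th edge of
  \<open>G\<close> in an \<open>n\<close> by \<open>n\<close> cell. The labellings that fail on some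
  subgrid are too few to exhaust all labellings. The functions \<open>x\<close> and \<open>y\<close>
  pick the rows and columns of a successful cell.\<close>

lemma increasing_labelling_exists:
  fixes p :: "nat \<Rightarrow> nat \<times> nat"
  assumes "0 < n" "d \<le> n" and p: "inj_on p {..<m}" "p ` {..<m} \<subseteq> {..<n} \<times> {..<n}"
    and t: "t = 3 * n ^ 10 * fact m" and M: "M \<le> t ^ (2 * (d + 1))"
  obtains f :: "nat \<times> nat \<Rightarrow> nat" where
    "\<And>A B. A \<subseteq> {..<M} \<Longrightarrow> B \<subseteq> {..<M} \<Longrightarrow> card A = t \<Longrightarrow> card B = t \<Longrightarrow>
      \<exists>x y. inj_on x {..<n} \<and> x ` {..<n} \<subseteq> A \<and> inj_on y {..<n} \<and> y ` {..<n} \<subseteq> B \<and>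
        (\<forall>l' < m. \<forall>l<l'. f (x (fst (p l)), y (snd (p l))) < f (x (fst (p l')), y (snd (p l'))))"
proof -
  have card_m: "m \<le> n\<^sup>2"
    using card_mono[OF _ p(2)] card_image[OF p(1)] by (simp add: power2_eq_square)
  have "0 < t"
    using assms(1) by (simp add: t)
  show thesis
  proof (cases "n = 1")
    \<comment> \<open>For \<open>n = 1\<close> there is at most one position, so every labelling is
      increasing and the constant \<open>0\<close> serves. The numerical estimate covers only
      \<open>2 \<le> n\<close>.\<close>
    case True
    with card_m have m1: "m \<le> 1"
      by simp
    show thesis
    proof (rule that)
      fix A B :: "nat set" assume "card A = t" "card B = t"
      then obtain a b where "a \<in> A" "b \<in> B"
        using \<open>0 < t\<close> by (metis card.empty equals0I less_irrefl)
      then have "inj_on (\<lambda>_. a) {..<n} \<and> (\<lambda>_. a) ` {..<n} \<subseteq> A \<and>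
        inj_on (\<lambda>_. b) {..<n} \<and> (\<lambda>_. b) ` {..<n} \<subseteq> B"
        using True by (auto simp: inj_on_def)
      then show "\<exists>x y. inj_on x {..<n} \<and> x ` {..<n} \<subseteq> A \<and> inj_on y {..<n} \<and> y ` {..<n} \<subseteq> B \<and>
        (\<forall>l' < m. \<forall>l<l'. 0 < (0::nat))"
        using m1 by fastforce
    qed
  next
    case False
    then have n2: "2 \<le> n"
      using assms(1) by simp
    \<comment> \<open>As \<open>t = K * n\<close>, a \<open>t\<close> by \<open>t\<close> subgrid
      splits into \<open>K\<^sup>2\<close> cells of size \<open>n\<close> by
      \<open>n\<close>.\<close>
    define K Q where "K = 3 * n ^ 9 * fact m" and "Q = 2 * m\<^sup>2 + 1"
    have Q0: "0 < Q"
      by (simp add: Q_def)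
    define \<beta> :: real where "\<beta> = 1 - 1 / (2 * fact m)"
    have \<beta>0: "0 \<le> \<beta>"
    proof -
      have "(1::real) \<le> 2 * fact m"
        using fact_ge_1[of m, where 'a = real] by linarith
      then show ?thesis
        by (simp add: \<beta>_def)
    qed
    have tK: "t = K * n"
      by (simp add: t K_def eval_nat_numeral algebra_simps)
    define S where "S = {..<M} \<times> {..<M}"
    \<comment> \<open>A subgrid is represented by injective enumerations of its rows and columns, so
      that its cells arise by cutting the index range into intervals of length
      \<open>n\<close>.\<close>
    define Inj where "Inj = {a \<in> {..<t} \<rightarrow>\<^sub>E {..<M}. inj_on a {..<t}}"
    define cell where
      "cell a b ij l = (a (fst ij * n + fst (p l)), b (snd ij * n + snd (p l)))"
      for a b :: "nat \<Rightarrow> nat" and ij l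
    define inc where "inc a b ij f \<longleftrightarrow> (\<forall>l' < m. \<forall>l<l'. f (cell a b ij l) < f (cell a b ij l'))"
      for a b ij and f :: "nat \<times> nat \<Rightarrow> nat"
    define bad where "bad ab = {f \<in> S \<rightarrow>\<^sub>E {..<Q}. \<forall>ij \<in> {..<K} \<times> {..<K}. \<not> inc (fst ab) (snd ab) ij f}"
      for ab
    have idx: "i * n + k < t" if "i < K" "k < n" for i k
    proof -
      have "i * n + k < (i + 1) * n"
        using that by simp
      also have "\<dots> \<le> K * n"
        using that by (intro mult_right_mono) auto
      finally show ?thesis
        by (simp add: tK)
    qed
    have idx_eq: "i = i' \<and> k = k'" if "i * n + k = i' * n + k'" "k < n" "k' < n" for i i' k k'
    proof -
      have "(a * n + b) div n = a" if "b < n" for a b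
        using that by simp
      then have "i = i'"
        using that by metis
      then show ?thesis
        using that by simp
    qed
    have sub_inj: "inj_on (\<lambda>k. a (i * n + k)) {..<n}" if "a \<in> Inj" "i < K" for a i
    proof (rule inj_onI)
      fix k k' assume k: "k \<in> {..<n}" "k' \<in> {..<n}" "a (i * n + k) = a (i * n + k')"
      have "inj_on a {..<t}"
        using that by (simp add: Inj_def)
      from inj_onD[OF this k(3)] have "i * n + k = i * n + k'"
        using idx[OF that(2)] k(1,2) by simp
      then show "k = k'"
        by simp
    qed
    have pn: "fst (p l) < n" "snd (p l) < n" if "l < m" for l
      using p(2) that by force+
    \<comment> \<open>Injectivity in \<open>ij\<close> makes different cells disjoint, which gives
      independence; injectivity in \<open>l\<close> makes \<open>cell a b ij\<close> a bijection
      onto the positions used in one cell.\<close>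
    have cell_eq: "ij = ij' \<and> l = l'"
      if "cell a b ij l = cell a b ij' l'" "a \<in> Inj" "b \<in> Inj" "l < m" "l' < m"
        "ij \<in> {..<K} \<times> {..<K}" "ij' \<in> {..<K} \<times> {..<K}" for a b ij ij' l l'
    proof -
      have "fst ij * n + fst (p l) = fst ij' * n + fst (p l')"
        using that pn idx by (auto simp: Inj_def cell_def inj_on_def)
      moreover have "snd ij * n + snd (p l) = snd ij' * n + snd (p l')"
        using that pn idx by (auto simp: Inj_def cell_def inj_on_def)
      ultimately have "ij = ij' \<and> p l = p l'"
        using idx_eq pn that by (metis prod.expand)
      then show ?thesis
        using p(1) that by (auto simp: inj_on_def)
    qed
    have card_bad: "real (card (bad ab)) \<le> \<beta> ^ K\<^sup>2 * real Q ^ card S" if ab: "ab \<in> Inj \<times> Inj" for ab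
    proof -
      obtain a b where [simp]: "ab = (a, b)" and a: "a \<in> Inj" and b: "b \<in> Inj"
        using ab by auto
      let ?T = "\<lambda>ij. cell a b ij ` {..<m}"
      have "real (card {f \<in> S \<rightarrow>\<^sub>E {..<Q}. \<forall>ij\<in>{..<K} \<times> {..<K}. \<not> inc a b ij f})
        \<le> \<beta> ^ card ({..<K} \<times> {..<K}) * real (card {..<Q}) ^ card S"
      proof (rule card_PiE_avoid_le[where T = ?T])
        show "?T ij \<subseteq> S" if ij: "ij \<in> {..<K} \<times> {..<K}" for ij
        proof (rule image_subsetI)
          fix l assume "l \<in> {..<m}"
          then show "cell a b ij l \<in> S"
            using a b ij pn idx by (auto simp: S_def cell_def Inj_def PiE_iff)
        qed
        show "?T ij \<inter> ?T ij' = {}" if "ij \<in> {..<K} \<times> {..<K}" "ij' \<in> {..<K} \<times> {..<K}" "ij \<noteq> ij'" for ij ij'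
        proof (rule ccontr)
          assume "\<not> ?thesis"
          then obtain z where "z \<in> ?T ij" "z \<in> ?T ij'"
            by blast
          then obtain l l' where l: "l \<in> {..<m}" "l' \<in> {..<m}" and z: "z = cell a b ij l" "z = cell a b ij' l'"
            by blast
          then have "cell a b ij l = cell a b ij' l'" "l < m" "l' < m"
            by auto
          from cell_eq[OF this(1) a b this(2,3) that(1,2)] that(3) show False
            by blast
        qed
        show "inc a b ij f \<longleftrightarrow> inc a b ij g" if "\<And>x. x \<in> ?T ij \<Longrightarrow> f x = g x" for ij f g
        proof -
          have "f (cell a b ij l) = g (cell a b ij l)" if "l < m" for l
            using that \<open>\<And>x. x \<in> ?T ij \<Longrightarrow> f x = g x\<close> by blast
          then show ?thesis
            unfolding inc_def by (intro all_cong) simp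
        qed
        show "real (card {f \<in> ?T ij \<rightarrow>\<^sub>E {..<Q}. \<not> inc a b ij f}) \<le> \<beta> * real (card {..<Q}) ^ card (?T ij)"
          if ij: "ij \<in> {..<K} \<times> {..<K}" for ij
        proof -
          have "bij_betw (cell a b ij) {..<m} (?T ij)"
            using cell_eq[OF _ a b _ _ ij ij] by (auto simp: bij_betw_def inj_on_def)
          from card_not_increasing_labellings_le[OF this] show ?thesis
            by (simp add: inc_def \<beta>_def Q_def)
        qed
      qed (use \<beta>0 in \<open>auto simp: S_def\<close>)
      then show ?thesis
        by (simp add: bad_def power2_eq_square)
    qed
    have fin_Inj: "finite Inj"
      unfolding Inj_def by (rule finite_subset[OF _ finite_PiE[of "{..<t}" "\<lambda>_. {..<M}"]]) auto
    have card_Inj: "card Inj \<le> M ^ t"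
    proof -
      have "card Inj \<le> card ({..<t} \<rightarrow>\<^sub>E {..<M})"
        unfolding Inj_def by (intro card_mono finite_PiE) auto
      then show ?thesis
        by (simp add: card_PiE)
    qed
    \<comment> \<open>Union bound, with one summand for each of at most \<open>M ^ (2 * t)\<close>
      pairs of enumerations.\<close>
    have "real (card (\<Union>ab \<in> Inj \<times> Inj. bad ab)) \<le> (\<Sum>ab \<in> Inj \<times> Inj. real (card (bad ab)))"
      using card_UN_le[of "Inj \<times> Inj" bad] fin_Inj by (simp flip: of_nat_sum)
    also have "\<dots> \<le> real (card (Inj \<times> Inj)) * (\<beta> ^ K\<^sup>2 * real Q ^ card S)"
      using card_bad by (rule sum_bounded_above)
    also have "\<dots> \<le> real (M ^ t * M ^ t) * (\<beta> ^ K\<^sup>2 * real Q ^ card S)"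
      using \<beta>0 mult_mono[OF card_Inj card_Inj]
      by (intro mult_right_mono) (auto simp only: card_cartesian_product of_nat_le_iff
          intro!: mult_nonneg_nonneg zero_le_power of_nat_0_le_iff)
    also have "\<dots> = (real M ^ (2 * t) * \<beta> ^ K\<^sup>2) * real Q ^ card S"
      by (simp add: mult_2 power_add)
    also have "\<dots> < 1 * real Q ^ card S"
      using union_bound_estimate[OF n2 card_m assms(2) t M]
      by (intro mult_strict_right_mono) (simp_all add: \<beta>_def K_def Q0)
    also have "\<dots> = real (card (S \<rightarrow>\<^sub>E {..<Q}))"
      by (simp add: card_PiE S_def)
    finally have "card (\<Union>ab \<in> Inj \<times> Inj. bad ab) < card (S \<rightarrow>\<^sub>E {..<Q})"
      by simp
    then have "\<not> (S \<rightarrow>\<^sub>E {..<Q}) \<subseteq> (\<Union>ab \<in> Inj \<times> Inj. bad ab)"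
    proof -
      have "finite (S \<rightarrow>\<^sub>E {..<Q})"
        by (intro finite_PiE) (auto simp: S_def)
      then have "finite (bad ab)" for ab
        unfolding bad_def by (rule rev_finite_subset) auto
      with fin_Inj have "finite (\<Union>ab \<in> Inj \<times> Inj. bad ab)"
        by blast
      then show ?thesis
        using card_mono \<open>card (\<Union>ab \<in> Inj \<times> Inj. bad ab) < card (S \<rightarrow>\<^sub>E {..<Q})\<close>
        by (meson not_le)
    qed
    then obtain f where f: "f \<in> S \<rightarrow>\<^sub>E {..<Q}" "\<And>ab. ab \<in> Inj \<times> Inj \<Longrightarrow> f \<notin> bad ab"
      by blast
    show thesis
    proof (rule that)
      fix A B :: "nat set"
      assume AB: "A \<subseteq> {..<M}" "B \<subseteq> {..<M}" "card A = t" "card B = t"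
      have enum: "\<exists>a\<in>Inj. a ` {..<t} = X" if X: "X \<subseteq> {..<M}" "card X = t" for X
      proof -
        have "finite X"
          using X finite_subset by auto
        then obtain g where g: "bij_betw g {..<t} X"
          using ex_bij_betw_nat_finite[of X] X(2) by (auto simp: atLeast0LessThan)
        then have "restrict g {..<t} \<in> Inj" "restrict g {..<t} ` {..<t} = X"
          using X by (auto simp: Inj_def bij_betw_def inj_on_def)
        then show ?thesis
          by blast
      qed
      obtain a b where a: "a \<in> Inj" "a ` {..<t} = A" and b: "b \<in> Inj" "b ` {..<t} = B"
        using enum AB by metis
      have "f \<notin> bad (a, b)"
        using f(2) a b by blast
      then obtain i j where ij: "i < K" "j < K" and incr: "inc a b (i, j) f"
        using f(1) by (auto simp: bad_def)
      let ?x = "\<lambda>k. a (i * n + k)" and ?y = "\<lambda>k. b (j * n + k)"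
      have "inj_on ?x {..<n}" "?x ` {..<n} \<subseteq> A"
        using a ij(1) sub_inj idx by auto
      moreover have "inj_on ?y {..<n}" "?y ` {..<n} \<subseteq> B"
        using b ij(2) sub_inj idx by auto
      ultimately show "\<exists>x y. inj_on x {..<n} \<and> x ` {..<n} \<subseteq> A \<and> inj_on y {..<n} \<and> y ` {..<n} \<subseteq> B \<and>
        (\<forall>l' < m. \<forall>l<l'. f (x (fst (p l)), y (snd (p l))) < f (x (fst (p l')), y (snd (p l'))))"
        using incr by (intro exI[of _ ?x] exI[of _ ?y]) (simp add: inc_def cell_def)
    qed
  qed
qed

section \<open>Greedy embedding along a degeneracy order\<close>

text \<open>\<open>R i a j b\<close> abstracts a red edge between position \<open>a\<close> of block
  \<open>i\<close> and position \<open>b\<close> of block \<open>j\<close>. Vertices are embedded in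
  the order of their indices. The hypothesis \<open>grid\<close> ensures that some candidate shrinks
  no later neighbour's candidate set by more than a factor \<open>t\<close>.\<close>

lemma greedy_embedding:
  fixes adj :: "nat \<Rightarrow> nat \<Rightarrow> bool" and R :: "nat \<Rightarrow> nat \<Rightarrow> nat \<Rightarrow> nat \<Rightarrow> bool"
  assumes "0 < t" "0 < s" and M: "M = s * t ^ (d + 1)"
    and back_degree: "\<And>j. j < s \<Longrightarrow> card {i. i < j \<and> adj i j} \<le> d"
    and grid: "\<And>i j A B. i < j \<Longrightarrow> j < s \<Longrightarrow> adj i j \<Longrightarrow> A \<subseteq> {..<M} \<Longrightarrow> B \<subseteq> {..<M} \<Longrightarrow>
      card A = t \<Longrightarrow> card B = t \<Longrightarrow> \<exists>a\<in>A. \<exists>b\<in>B. R i a j b"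
  obtains u where "\<And>i. i < s \<Longrightarrow> u i < M"
    and "\<And>i j. i < j \<Longrightarrow> j < s \<Longrightarrow> adj i j \<Longrightarrow> R i (u i) j (u j)"
proof -
  \<comment> \<open>\<open>cand u k j\<close> collects the positions for \<open>j\<close> that agree
    with the choices \<open>u\<close> made below \<open>k\<close>; \<open>deg k j\<close> counts the
    neighbours of \<open>j\<close> embedded by then.\<close>
  define cand where "cand u k j = {v. v < M \<and> (\<forall>i<k. adj i j \<longrightarrow> R i (u i) j v)}" for u k j
  define deg where "deg k j = card {i. i < k \<and> adj i j}" for k j
  have fin_cand: "finite (cand u k j)" for u k j
    by (simp add: cand_def)
  have "\<exists>u. (\<forall>i<k. u i \<in> cand u i i) \<and> (\<forall>j\<in>{k..<s}. s * t ^ (d + 1 - deg k j) \<le> card (cand u k j))"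
    if "k \<le> s" for k
    using that
  proof (induction k)
    case 0
    then show ?case
      by (auto simp: cand_def deg_def M)
  next
    case (Suc k)
    then have ks: "k < s"
      by simp
    from Suc.IH[OF less_imp_le[OF ks]] obtain u where u: "\<forall>i<k. u i \<in> cand u i i"
      and "\<forall>j\<in>{k..<s}. s * t ^ (d + 1 - deg k j) \<le> card (cand u k j)"
      by blast
    then have card_cand: "s * t ^ (d + 1 - deg k j) \<le> card (cand u k j)" if "k \<le> j" "j < s" for j
      using that by simp
    have deg_le: "deg k j \<le> d" if "k \<le> j" "j < s" for j
    proof -
      have "deg k j \<le> card {i. i < j \<and> adj i j}"
        unfolding deg_def using that by (intro card_mono) auto
      then show ?thesis
        using back_degree[OF that(2)] by simp
    qed
    let ?C = "cand u k k"
    let ?nb = "\<lambda>x j. {v \<in> cand u k j. R k x j v}"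
    \<comment> \<open>The exponent drops by one exactly for the later neighbours of
      \<open>k\<close>, whose number of embedded neighbours grows by one.\<close>
    have "\<exists>x\<in>?C. \<forall>j\<in>{k<..<s}. adj k j \<longrightarrow> s * t ^ (d - deg k j) \<le> card (?nb x j)"
    proof (rule ccontr)
      assume contr: "\<not> ?thesis"
      let ?J = "{j \<in> {k<..<s}. adj k j}"
      let ?W = "\<lambda>j. {x \<in> ?C. card (?nb x j) < s * t ^ (d - deg k j)}"
      have "?C \<subseteq> (\<Union>j\<in>?J. ?W j)"
        using contr by (force simp: not_le)
      then have C_le: "card ?C \<le> (\<Sum>j\<in>?J. card (?W j))"
        using card_mono[of "\<Union>j\<in>?J. ?W j" ?C] card_UN_le[of ?J ?W] fin_cand by fastforce
      \<comment> \<open>Pigeonhole: \<open>deg k k \<le> d\<close> leaves at least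
        \<open>s * t\<close> candidates for \<open>k\<close>, and these are covered by at most
        \<open>s\<close> sets \<open>?W j\<close>.\<close>
      have "\<exists>j\<in>?J. t \<le> card (?W j)"
      proof (rule ccontr)
        assume "\<not> ?thesis"
        then have "card (?W j) < t" if "j \<in> ?J" for j
          using that not_le by blast
        then have "card (?W j) \<le> t - 1" if "j \<in> ?J" for j
          using that by fastforce
        then have "(\<Sum>j\<in>?J. card (?W j)) \<le> card ?J * (t - 1)"
          using sum_bounded_above[of ?J "\<lambda>j. card (?W j)" "t - 1"] by simp
        also have "\<dots> \<le> s * (t - 1)"
          using card_mono[of "{k<..<s}" ?J] by (intro mult_right_mono) fastforce+
        also have "\<dots> < s * t"
          using assms by simp
        also have "\<dots> \<le> s * t ^ (d + 1 - deg k k)"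
          using deg_le[of k] ks assms(1) self_le_power[of t "d + 1 - deg k k"] by simp
        also have "\<dots> \<le> card ?C"
          using card_cand[of k] ks by simp
        finally show False
          using C_le by simp
      qed
      then obtain j where j: "k < j" "j < s" "adj k j" "t \<le> card (?W j)"
        by auto
      obtain A where A: "A \<subseteq> ?W j" "card A = t"
        using obtain_subset_with_card_n[OF j(4)] by blast
      have fin_A: "finite A"
        using A(2) assms(1) by (metis card.infinite less_irrefl)
      \<comment> \<open>Each element of \<open>A\<close> has at most \<open>c - 1\<close> partners
        among the candidates of \<open>j\<close>, so all of \<open>A\<close> reaches at most
        \<open>t * (c - 1)\<close> of them. There are at least \<open>t * c\<close> candidates, and
        \<open>t\<close> unreached ones form a set \<open>B\<close> that contradicts
        \<open>grid\<close>.\<close>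
      define c where "c = s * t ^ (d - deg k j)"
      have c1: "1 \<le> c"
        using assms by (simp add: c_def Suc_le_eq)
      let ?U = "\<Union>x\<in>A. ?nb x j"
      have "card ?U \<le> (\<Sum>x\<in>A. card (?nb x j))"
        using card_UN_le[OF fin_A] .
      also have "\<dots> \<le> t * (c - 1)"
        using sum_bounded_above[of A "\<lambda>x. card (?nb x j)" "c - 1"] A c1 by (fastforce simp: c_def)
      finally have card_U: "card ?U \<le> t * (c - 1)" .
      have "d + 1 - deg k j = Suc (d - deg k j)"
        using deg_le[of j] j by simp
      then have "t * c \<le> card (cand u k j)"
        using card_cand[of j] j by (simp add: c_def algebra_simps)
      moreover have "t * c = t * (c - 1) + t"
        using c1 by (cases c) auto
      moreover have "card (cand u k j) - card ?U \<le> card (cand u k j - ?U)"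
        using fin_A fin_cand by (intro diff_card_le_card_Diff) auto
      ultimately have "t \<le> card (cand u k j - ?U)"
        using card_U by linarith
      then obtain B where B: "B \<subseteq> cand u k j - ?U" "card B = t"
        using obtain_subset_with_card_n by blast
      have "A \<subseteq> {..<M}" "B \<subseteq> {..<M}"
        using A B by (auto simp: cand_def)
      then obtain a b where "a \<in> A" "b \<in> B" "R k a j b"
        using grid[of k j A B] j A B by auto
      then show False
        using B by auto
    qed
    then obtain x where x: "x \<in> ?C"
      and nb: "\<And>j. k < j \<Longrightarrow> j < s \<Longrightarrow> adj k j \<Longrightarrow> s * t ^ (d - deg k j) \<le> card (?nb x j)"
      by auto
    let ?u = "u(k := x)"
    have cand_eq: "cand ?u i j = cand u i j" if "i \<le> k" for i j
      using that by (auto simp: cand_def)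
    have "s * t ^ (d + 1 - deg (Suc k) j) \<le> card (cand ?u (Suc k) j)" if j: "k < j" "j < s" for j
    proof (cases "adj k j")
      case True
      have "{i. i < Suc k \<and> adj i j} = insert k {i. i < k \<and> adj i j}"
        using True by (auto simp: less_Suc_eq)
      then have "deg (Suc k) j = Suc (deg k j)"
        by (simp add: deg_def)
      moreover have "cand ?u (Suc k) j = ?nb x j"
        using True by (auto simp: cand_def less_Suc_eq)
      ultimately show ?thesis
        using nb[OF j True] by simp
    next
      case False
      then have "{i. i < Suc k \<and> adj i j} = {i. i < k \<and> adj i j}"
        by (auto simp: less_Suc_eq)
      then have "deg (Suc k) j = deg k j"
        by (simp add: deg_def)
      moreover have "cand ?u (Suc k) j = cand u k j"
        using False by (auto simp: cand_def less_Suc_eq)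
      ultimately show ?thesis
        using card_cand[of j] j by simp
    qed
    moreover have "?u i \<in> cand ?u i i" if "i < Suc k" for i
      using that u x cand_eq by (auto simp: less_Suc_eq)
    ultimately show ?case
      by (intro exI[of _ ?u] conjI allI ballI impI) (simp_all only: atLeastLessThan_iff Suc_le_eq)
  qed
  from this[of s] obtain u where "\<And>i. i < s \<Longrightarrow> u i \<in> cand u i i"
    by auto
  then show thesis
    by (intro that[of u]) (auto simp: cand_def)
qed

text \<open>A vertex of degree at most \<open>d\<close> is put last and deleted. The remaining graph
  is again \<open>d\<close>-degenerate, so induction enumerates it.\<close>

lemma degenerate_enumeration:
  assumes "simple_graph V E" "degenerate d V E"
  obtains w where "bij_betw w {..<card V} V"
    and "\<And>j. j < card V \<Longrightarrow> card {i. i < j \<and> {w i, w j} \<in> E} \<le> d"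
proof -
  have "\<exists>w. bij_betw w {..<k} V \<and> (\<forall>j<k. card {i. i < j \<and> {w i, w j} \<in> E} \<le> d)"
    if "simple_graph V E" "degenerate d V E" "card V = k" for k
    using that
  proof (induction k arbitrary: V E)
    case 0
    then show ?case
      by (auto simp: simple_graph_def bij_betw_def)
  next
    case (Suc k)
    have fin: "finite V"
      using Suc.prems by (simp add: simple_graph_def)
    have finE: "finite E"
      using Suc.prems(1) finite_subset[of E "Pow V"] by (auto simp: simple_graph_def)
    obtain v where v: "v \<in> V" "degree E v \<le> d"
      using Suc.prems unfolding degenerate_def subgraph_def by fastforce
    let ?V = "V - {v}" and ?E = "{e \<in> E. v \<notin> e}"
    have sg: "simple_graph ?V ?E"
      using Suc.prems(1) by (auto simp: simple_graph_def)
    have "degenerate d ?V ?E"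
      using Suc.prems(1,2) unfolding degenerate_def subgraph_def by blast
    with sg obtain w where w: "bij_betw w {..<k} ?V"
      and wd: "\<And>j. j < k \<Longrightarrow> card {i. i < j \<and> {w i, w j} \<in> ?E} \<le> d"
      using Suc.IH[of ?V ?E] Suc.prems(3) v(1) fin by auto
    let ?w = "w(k := v)"
    have "bij_betw ?w {..<k} ?V"
      using w by (rule bij_betw_cong[THEN iffD1, rotated]) auto
    then have "bij_betw ?w ({..<k} \<union> {k}) (?V \<union> {v})"
      by (rule bij_betw_combine) (auto simp: bij_betw_def)
    then have bij: "bij_betw ?w {..<Suc k} V"
      using v(1) by (simp add: lessThan_Suc insert_absorb)
    have "card {i. i < j \<and> {?w i, ?w j} \<in> E} \<le> d" if "j < Suc k" for j
    proof (cases "j = k")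
      case True
      \<comment> \<open>Distinct earlier neighbours of \<open>v\<close> give distinct edges at
        \<open>v\<close>.\<close>
      have "card {i. i < k \<and> {w i, v} \<in> E} \<le> card {e \<in> E. v \<in> e}"
      proof (rule card_inj_on_le[where f = "\<lambda>i. {w i, v}"])
        show "inj_on (\<lambda>i. {w i, v}) {i. i < k \<and> {w i, v} \<in> E}"
          using w by (auto simp: inj_on_def bij_betw_def doubleton_eq_iff)
      qed (use finE in auto)
      moreover have "{i. i < j \<and> {?w i, ?w j} \<in> E} = {i. i < k \<and> {w i, v} \<in> E}"
        using True by auto
      ultimately show ?thesis
        using v(2) by (simp add: degree_def)
    next
      case False
      then have jk: "j < k"
        using that by simp
      have "w i \<noteq> v" if "i < k" for i
        using w that by (auto simp: bij_betw_def)
      then have "{i. i < j \<and> {?w i, ?w j} \<in> E} = {i. i < j \<and> {w i, w j} \<in> ?E}"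
        using jk by (auto dest: less_trans)
      then show ?thesis
        using wd[OF jk] by simp
    qed
    with bij show ?case
      by blast
  qed
  then show thesis
    using assms that by blast
qed

section \<open>Constructing copies and edge-orderings\<close>

text \<open>The copy is the image of \<open>G\<close> with the order induced by \<open>K\<close>.
  One direction of order preservation suffices: the order of \<open>G\<close> is total, that of
  \<open>K\<close> is antisymmetric, and \<open>h\<close> is injective on edges. The edges of the
  copy are exposed so that their colours can be checked.\<close>

lemma copy_inI:
  assumes G: "edge_ordered_graph G" and K: "edge_ordered_graph K"
    and h: "inj_on h (verts G)" "h ` verts G \<subseteq> verts K" "\<And>e. e \<in> edges G \<Longrightarrow> h ` e \<in> edges K"
    and ord: "\<And>e e'. e \<in> edges G \<Longrightarrow> e' \<in> edges G \<Longrightarrow> e \<noteq> e' \<Longrightarrow> (e, e') \<in> edge_order G \<Longrightarrow>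
      (h ` e, h ` e') \<in> edge_order K"
  obtains C where "copy_in C G K" "edges C = (`) h ` edges G"
proof -
  let ?E = "(`) h ` edges G"
  let ?C = "\<lparr>verts = h ` verts G, edges = ?E, edge_order = Restr (edge_order K) ?E\<rparr>"
  have sG: "finite (verts G)" "\<And>e. e \<in> edges G \<Longrightarrow> e \<subseteq> verts G \<and> card e = 2"
    using G by (auto simp: edge_ordered_graph_def simple_graph_def)
  have sub: "?E \<subseteq> edges K"
    using h(3) by auto
  have sC: "simple_graph (h ` verts G) ?E"
    using sG h(1) by (auto simp: simple_graph_def card_image inj_on_subset)
  have lin: "linear_order_on ?E (Restr (edge_order K) ?E)"
    using K sub by (intro linear_order_on_subset[of "edges K"]) (auto simp: edge_ordered_graph_def)
  have inj_E: "inj_on ((`) h) (edges G)"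
  proof (rule inj_onI)
    fix e e' assume "e \<in> edges G" "e' \<in> edges G" "h ` e = h ` e'"
    then show "e = e'"
      using inj_on_image_eq_iff[OF h(1)] sG(2) by blast
  qed
  have "edge_ordered_subgraph ?C K"
    using K lin sC sub h(2) by (auto simp: edge_ordered_subgraph_def edge_ordered_graph_def subgraph_def)
  moreover have "graph_iso h (verts G) (edges G) (h ` verts G) ?E"
  proof -
    have "{u, v} \<in> edges G \<longleftrightarrow> {h u, h v} \<in> ?E" if uv: "u \<in> verts G" "v \<in> verts G" for u v
    proof
      assume "{u, v} \<in> edges G"
      then have "h ` {u, v} \<in> ?E"
        by blast
      then show "{h u, h v} \<in> ?E"
        by simp
    next
      assume "{h u, h v} \<in> ?E"
      then obtain e where e: "e \<in> edges G" "h ` {u, v} = h ` e"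
        by auto
      then have "{u, v} = e"
        using sG(2) uv h(1) by (subst (asm) inj_on_image_eq_iff[of h "verts G"]) auto
      then show "{u, v} \<in> edges G"
        using e by simp
    qed
    then show ?thesis
      using h(1) by (simp add: graph_iso_def bij_betw_def)
  qed
  moreover have "(e, e') \<in> edge_order G \<longleftrightarrow> (h ` e, h ` e') \<in> Restr (edge_order K) ?E"
    if e: "e \<in> edges G" "e' \<in> edges G" for e e'
  proof (cases "e = e'")
    case True
    then show ?thesis
      using G K e h(3) unfolding edge_ordered_graph_def linear_order_on_def partial_order_on_def
        preorder_on_def refl_on_def by auto
  next
    case False
    then have ne: "h ` e \<noteq> h ` e'"
      using inj_E e by (auto dest: inj_onD)
    have anti: "\<not> ((h ` e, h ` e') \<in> edge_order K \<and> (h ` e', h ` e) \<in> edge_order K)"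
      using K ne unfolding edge_ordered_graph_def linear_order_on_def partial_order_on_def antisym_def
      by blast
    have "(e, e') \<in> edge_order G \<or> (e', e) \<in> edge_order G"
      using G e False unfolding edge_ordered_graph_def linear_order_on_def total_on_def by blast
    then show ?thesis
      using ord[OF e False] ord[OF e(2,1)] False anti e by blast
  qed
  ultimately have "copy_in ?C G K"
    unfolding copy_in_def edge_ordered_iso_def by (intro conjI exI[of _ h]) auto
  then show thesis
    by (intro that) auto
qed

text \<open>The order is pulled back along \<open>key\<close> from a linearly ordered type;
  injectivity supplies antisymmetry.\<close>

lemma edge_ordering_of_complete_key:
  fixes key :: "nat set \<Rightarrow> 'k::linorder" and N :: nat
  defines "E \<equiv> {e. e \<subseteq> {..<N} \<and> card e = 2}"
  assumes "inj_on key E"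
  shows "edge_ordering_of_complete N
    \<lparr>verts = {..<N}, edges = E, edge_order = {(e, e'). e \<in> E \<and> e' \<in> E \<and> key e \<le> key e'}\<rparr>"
proof -
  have "linear_order_on E {(e, e'). e \<in> E \<and> e' \<in> E \<and> key e \<le> key e'}"
    unfolding linear_order_on_def partial_order_on_def preorder_on_def refl_on_def total_on_def
      antisym_def trans_def
    using assms(2) by (auto dest: inj_onD)
  then show ?thesis
    by (auto simp: edge_ordering_of_complete_def edge_ordered_graph_def simple_graph_def E_def)
qed

section \<open>The ordered complete graph and the two cases of a colouring\<close>

theorem theorem2:
  fixes H :: "'a edge_ordered_graph" and G :: "'b edge_ordered_graph"
    and d n n' m t :: nat
  assumes "d > 0" and "n > 0" and "n' > 0"
    and "edge_ordered_graph H" and "degenerate d (verts H) (edges H)" and "card (verts H) = n'"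
    and "edge_ordered_graph G" and "card (edges G) = m"
    and "\<exists>A B. bipartition A B (verts G) (edges G) \<and> card A = n \<and> card B = n"
    and "t = 3 * n ^ 10 * fact m"
    and "d \<le> n" and "n' \<le> t ^ (d + 1)"
  shows "edge_ordered_ramsey H G \<le> enat (n' ^ 2 * t ^ (d + 1))"
proof -
  have sH: "simple_graph (verts H) (edges H)" and sG: "simple_graph (verts G) (edges G)"
    using assms(4,7) by (auto simp: edge_ordered_graph_def)
  have finH: "finite (edges H)" and finG: "finite (edges G)"
    using sH sG finite_subset[of "edges H" "Pow (verts H)"] finite_subset[of "edges G" "Pow (verts G)"]
    by (auto simp: simple_graph_def)
  have t0: "0 < t"
    using assms(2,10) by simp
  \<comment> \<open>The number \<open>i * M + a\<close> with \<open>a < M\<close> encodes position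
    \<open>a\<close> of block \<open>i\<close>.\<close>
  define M where "M = n' * t ^ (d + 1)"
  define N where "N = n' * M"
  have M0: "0 < M"
    using t0 assms(3) by (simp add: M_def)
  \<comment> \<open>The hypothesis \<open>n' \<le> t ^ (d + 1)\<close> enters here: it keeps the
    grid small enough for the union bound.\<close>
  have M_le: "M \<le> t ^ (2 * (d + 1))"
    using mult_right_mono[OF assms(12), of "t ^ (d + 1)"] by (simp only: M_def mult_2 power_add)
  obtain w where w: "bij_betw w {..<n'} (verts H)"
    and w_deg: "\<And>j. j < n' \<Longrightarrow> card {i. i < j \<and> {w i, w j} \<in> edges H} \<le> d"
    using degenerate_enumeration[OF sH assms(5)] assms(6) by metis
  obtain rkH :: "'a set \<Rightarrow> nat" where
    rkH: "\<And>e e'. e \<in> edges H \<Longrightarrow> e' \<in> edges H \<Longrightarrow> e \<noteq> e' \<Longrightarrow> (e, e') \<in> edge_order H \<Longrightarrow> rkH e < rkH e'"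
    using linear_order_rank[OF finH] assms(4) by (metis edge_ordered_graph_def)
  obtain rkG :: "'b set \<Rightarrow> nat" where bij_rkG: "bij_betw rkG (edges G) {..<m}" and
    rkG: "\<And>e e'. e \<in> edges G \<Longrightarrow> e' \<in> edges G \<Longrightarrow> e \<noteq> e' \<Longrightarrow> (e, e') \<in> edge_order G \<Longrightarrow> rkG e < rkG e'"
    using linear_order_rank[OF finG] assms(7,8) by (metis edge_ordered_graph_def)
  obtain A B where bip: "bipartition A B (verts G) (edges G)" and card_AB: "card A = n" "card B = n"
    using assms(9) by blast
  then have AB: "A \<union> B = verts G" "A \<inter> B = {}"
    by (simp_all add: bipartition_def)
  from bip have AB_edge: "\<exists>a\<in>A. \<exists>b\<in>B. e = {a, b}" if "e \<in> edges G" for e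
    using that by (simp add: bipartition_def)
  have "finite A" "finite B"
    using sG unfolding simple_graph_def AB(1)[symmetric] by auto
  then obtain \<alpha> \<beta> where \<alpha>: "bij_betw \<alpha> A {..<n}" and \<beta>: "bij_betw \<beta> B {..<n}"
    using ex_bij_betw_finite_nat card_AB by (metis atLeast0LessThan)
  obtain xa xb where "\<And>e. e \<in> edges G \<Longrightarrow> xa e \<in> A \<and> xb e \<in> B \<and> e = {xa e, xb e}"
    using AB_edge by metis
  then have x: "xa e \<in> A" "xb e \<in> B" "{xa e, xb e} = e" if "e \<in> edges G" for e
    using that by auto
  define eG where "eG = inv_into (edges G) rkG"
  have eG: "eG l \<in> edges G" "rkG (eG l) = l" if "l < m" for l
    using that bij_rkG by (auto simp: eG_def bij_betw_def f_inv_into_f inv_into_into)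
  have eG_rkG: "eG (rkG e) = e" "rkG e < m" if "e \<in> edges G" for e
    using that bij_rkG by (auto simp: eG_def bij_betw_def)
  \<comment> \<open>The row numbers the endpoint in \<open>A\<close> of the \<open>l\<close>-th
    edge, the column its endpoint in \<open>B\<close>.\<close>
  define p where "p l = (\<alpha> (xa (eG l)), \<beta> (xb (eG l)))" for l
  have p_inj: "inj_on p {..<m}"
  proof (rule inj_onI)
    fix l l' assume l: "l \<in> {..<m}" "l' \<in> {..<m}" "p l = p l'"
    then have e: "eG l \<in> edges G" "eG l' \<in> edges G"
      using eG by auto
    have "xa (eG l) = xa (eG l')" "xb (eG l) = xb (eG l')"
      using l(3) x(1,2)[OF e(1)] x(1,2)[OF e(2)] \<alpha> \<beta> by (auto simp: p_def bij_betw_def dest: inj_onD)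
    then have "eG l = eG l'"
      using x(3)[OF e(1)] x(3)[OF e(2)] by metis
    then show "l = l'"
      using eG(2) l(1,2) by (metis lessThan_iff)
  qed
  have p_sub: "p ` {..<m} \<subseteq> {..<n} \<times> {..<n}"
  proof (rule image_subsetI)
    fix l assume "l \<in> {..<m}"
    then show "p l \<in> {..<n} \<times> {..<n}"
      using x(1,2)[OF eG(1)[of l]] \<alpha> \<beta> by (auto simp: p_def bij_betw_def)
  qed
  obtain f :: "nat \<times> nat \<Rightarrow> nat" where f:
    "\<And>A B. A \<subseteq> {..<M} \<Longrightarrow> B \<subseteq> {..<M} \<Longrightarrow> card A = t \<Longrightarrow> card B = t \<Longrightarrow>
      \<exists>x y. inj_on x {..<n} \<and> x ` {..<n} \<subseteq> A \<and> inj_on y {..<n} \<and> y ` {..<n} \<subseteq> B \<and>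
        (\<forall>l' < m. \<forall>l<l'. f (x (fst (p l)), y (snd (p l))) < f (x (fst (p l')), y (snd (p l'))))"
    using increasing_labelling_exists[OF assms(2,11) p_inj p_sub assms(10) M_le] by metis
  \<comment> \<open>The endpoints are appended only to make the key injective.\<close>
  define key where "key e = (rkH {w (Min e div M), w (Max e div M)}, f (Min e mod M, Max e mod M), Min e, Max e)"
    for e :: "nat set"
  define E where "E = {e. e \<subseteq> {..<N} \<and> card e = 2}"
  define K where "K = \<lparr>verts = {..<N}, edges = E,
    edge_order = {(e, e'). e \<in> E \<and> e' \<in> E \<and> key e \<le> key e'}\<rparr>"
  have "inj_on key E"
  proof (rule inj_onI)
    fix e e' assume "e \<in> E" "e' \<in> E" and eq: "key e = key e'"
    then have "\<exists>a b. e = {a, b}" "\<exists>a b. e' = {a, b}"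
      by (auto simp: E_def card_2_iff)
    moreover have "{a, b} = {Min {a, b}, Max {a, b}}" for a b :: nat
      by (cases "a \<le> b") (simp_all add: min_def max_def insert_commute)
    ultimately have "e = {Min e, Max e}" "e' = {Min e', Max e'}"
      by metis+
    then show "e = e'"
      using eq by (simp add: key_def)
  qed
  then have K: "edge_ordering_of_complete N K"
    unfolding K_def E_def by (rule edge_ordering_of_complete_key)
  then have K_eog: "edge_ordered_graph K"
    by (simp add: edge_ordering_of_complete_def)
  have block: "i * M + a < N" if "i < n'" "a < M" for i a
  proof -
    have "i * M + a < (i + 1) * M"
      using that by simp
    also have "\<dots> \<le> N"
      unfolding N_def using that by (intro mult_right_mono) auto
    finally show ?thesis .
  qed
  have block_less: "i * M + a < j * M + b" if "i < j" "a < M" for i j a b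
  proof -
    have "i * M + a < (i + 1) * M"
      using that by simp
    also have "\<dots> \<le> j * M"
      using that by (intro mult_right_mono) auto
    finally show ?thesis
      by simp
  qed
  have edgeK: "{i * M + a, j * M + b} \<in> E" if "i < j" "j < n'" "a < M" "b < M" for i j a b
    using that block block_less[of i j a b] by (auto simp: E_def card_insert_if)
  \<comment> \<open>The smaller endpoint lies in the lower block, so \<open>div\<close> and
    \<open>mod\<close> recover blocks and positions. For an edge inside a block, \<open>key\<close>
    evaluates \<open>rkH\<close> at a singleton; that value is arbitrary and harmless.\<close>
  have key_eq: "key {i * M + a, j * M + b} = (rkH {w i, w j}, f (a, b), i * M + a, j * M + b)"
    if "i < j" "a < M" "b < M" for i j a b
    using that block_less[of i j a b] by (simp add: key_def min_def max_def)
  have "edge_ramsey_arrows K H G"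
    unfolding edge_ramsey_arrows_def
  proof
    fix c :: "nat set \<Rightarrow> colour"
    let ?R = "\<lambda>i a j b. c {i * M + a, j * M + b} = Red"
    show "(\<exists>C. copy_in C H K \<and> (\<forall>e\<in>edges C. c e = Red)) \<or>
      (\<exists>C. copy_in C G K \<and> (\<forall>e\<in>edges C. c e = Blue))"
    \<comment> \<open>The case condition is the hypothesis \<open>grid\<close> of the greedy
      embedding for red edges. Its failure provides two blocks with an entirely blue
      \<open>t\<close> by \<open>t\<close> subgrid between them.\<close>
    proof (cases "\<forall>i j X Y. i < j \<longrightarrow> j < n' \<longrightarrow> {w i, w j} \<in> edges H \<longrightarrow> X \<subseteq> {..<M} \<longrightarrow> Y \<subseteq> {..<M} \<longrightarrow>
        card X = t \<longrightarrow> card Y = t \<longrightarrow> (\<exists>a\<in>X. \<exists>b\<in>Y. ?R i a j b)")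
      case True
      obtain u where u: "\<And>i. i < n' \<Longrightarrow> u i < M"
        and red: "\<And>i j. i < j \<Longrightarrow> j < n' \<Longrightarrow> {w i, w j} \<in> edges H \<Longrightarrow> ?R i (u i) j (u j)"
      proof (rule greedy_embedding[of t n' M d "\<lambda>i j. {w i, w j} \<in> edges H" ?R])
        show "\<exists>a\<in>X. \<exists>b\<in>Y. ?R i a j b"
          if "i < j" "j < n'" "{w i, w j} \<in> edges H" "X \<subseteq> {..<M}" "Y \<subseteq> {..<M}" "card X = t" "card Y = t"
          for i j X Y
          using True that by blast
      qed (use t0 assms(3) M_def w_deg in auto)
      define pos where "pos = inv_into {..<n'} w"
      have pos: "pos v < n'" "w (pos v) = v" if "v \<in> verts H" for v
        using that w inv_into_into[of v w "{..<n'}"] by (auto simp: pos_def bij_betw_def f_inv_into_f)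
      define h where "h v = pos v * M + u (pos v)" for v
      \<comment> \<open>Each edge of \<open>H\<close> is written with the smaller index first, the
        form to which \<open>red\<close> and \<open>key_eq\<close> apply.\<close>
      have h_edge: "\<exists>i j. i < j \<and> j < n' \<and> e = {w i, w j} \<and> h ` e = {i * M + u i, j * M + u j}"
        if e: "e \<in> edges H" for e
      proof -
        obtain v v' where v: "e = {v, v'}" "v \<noteq> v'" "v \<in> verts H" "v' \<in> verts H"
          using sH e by (auto simp: simple_graph_def card_2_iff)
        then have "pos v \<noteq> pos v'"
          using pos(2) by metis
        then consider "pos v < pos v'" | "pos v' < pos v"
          by linarith
        then show ?thesis
        proof cases
          case 1
          then show ?thesis
            using v pos by (intro exI[of _ "pos v"] exI[of _ "pos v'"]) (simp add: h_def)
        next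
          case 2
          then show ?thesis
            using v pos by (intro exI[of _ "pos v'"] exI[of _ "pos v"]) (simp add: h_def insert_commute)
        qed
      qed
      have h_in: "h ` e \<in> E" if "e \<in> edges H" for e
        using h_edge[OF that] edgeK u by (metis less_trans)
      obtain C where C: "copy_in C H K" "edges C = (`) h ` edges H"
      proof (rule copy_inI[OF assms(4) K_eog])
        show "inj_on h (verts H)"
        proof (rule inj_onI)
          fix v v' assume v: "v \<in> verts H" "v' \<in> verts H" "h v = h v'"
          then have "pos v = pos v'"
            using pos(1) u block_less by (metis h_def less_irrefl nat_neq_iff)
          then show "v = v'"
            using pos(2) v by metis
        qed
        show "h ` verts H \<subseteq> verts K"
          using pos(1) u block by (auto simp: h_def K_def)
        show "h ` e \<in> edges K" if "e \<in> edges H" for e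
          using h_in[OF that] by (simp add: K_def)
        show "(h ` e, h ` e') \<in> edge_order K"
          if e: "e \<in> edges H" "e' \<in> edges H" "e \<noteq> e'" "(e, e') \<in> edge_order H" for e e'
        proof -
          obtain i j where ij: "i < j" "j < n'" "e = {w i, w j}" "h ` e = {i * M + u i, j * M + u j}"
            using h_edge[OF e(1)] by blast
          obtain i' j' where ij': "i' < j'" "j' < n'" "e' = {w i', w j'}" "h ` e' = {i' * M + u i', j' * M + u j'}"
            using h_edge[OF e(2)] by blast
          \<comment> \<open>For distinct edges of \<open>H\<close> the rank, which is the first
            component of the key, already decides.\<close>
          have "fst (key (h ` e)) < fst (key (h ` e'))"
            using key_eq[of i j "u i" "u j"] key_eq[of i' j' "u i'" "u j'"] ij ij' u rkH[OF e] by simp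
          then have "key (h ` e) \<le> key (h ` e')"
            by (simp add: less_eq_prod_def)
          then show ?thesis
            using h_in e(1,2) by (simp add: K_def)
        qed
      qed
      have "c (h ` e) = Red" if "e \<in> edges H" for e
        using h_edge[OF that] red that by metis
      with C(2) have "\<forall>e\<in>edges C. c e = Red"
        by auto
      with C(1) show ?thesis
        by blast
    next
      case False
      then obtain i j X Y where ij: "i < j" "j < n'" and X: "X \<subseteq> {..<M}" "card X = t"
        and Y: "Y \<subseteq> {..<M}" "card Y = t" and blue: "\<And>a b. a \<in> X \<Longrightarrow> b \<in> Y \<Longrightarrow> \<not> ?R i a j b"
        by blast
      from f[OF X(1) Y(1) X(2) Y(2)] obtain x' y' where
        x': "inj_on x' {..<n}" "x' ` {..<n} \<subseteq> X" and y': "inj_on y' {..<n}" "y' ` {..<n} \<subseteq> Y"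
        and incr: "\<forall>l' < m. \<forall>l<l'. f (x' (fst (p l)), y' (snd (p l))) < f (x' (fst (p l')), y' (snd (p l')))"
        by iprover
      \<comment> \<open>The vertices of \<open>G\<close> are sent through their numbers in
        \<open>A\<close> and \<open>B\<close> to the rows and columns of the increasing
        cell.\<close>
      define r s where "r v = x' (\<alpha> v)" and "s v = y' (\<beta> v)" for v
      have r: "r v \<in> X" "r v < M" if "v \<in> A" for v
      proof -
        have "\<alpha> v \<in> {..<n}"
          using \<alpha> that by (rule bij_betw_apply)
        then show "r v \<in> X"
          using x'(2) by (auto simp: r_def)
        then show "r v < M"
          using X(1) by auto
      qed
      have s: "s v \<in> Y" "s v < M" if "v \<in> B" for v
      proof -
        have "\<beta> v \<in> {..<n}"
          using \<beta> that by (rule bij_betw_apply)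
        then show "s v \<in> Y"
          using y'(2) by (auto simp: s_def)
        then show "s v < M"
          using Y(1) by auto
      qed
      have r_inj: "inj_on r A"
        using comp_inj_on[of \<alpha> A x'] \<alpha> x'(1) by (simp add: r_def[abs_def] bij_betw_def comp_def)
      have s_inj: "inj_on s B"
        using comp_inj_on[of \<beta> B y'] \<beta> y'(1) by (simp add: s_def[abs_def] bij_betw_def comp_def)
      define h where "h v = (if v \<in> A then i * M + r v else j * M + s v)" for v
      have hA: "h v = i * M + r v" if "v \<in> A" for v
        using that by (simp add: h_def)
      have hB: "h v = j * M + s v" if "v \<in> B" for v
        using that AB(2) by (auto simp: h_def)
      have h_edge: "h ` e = {i * M + r (xa e), j * M + s (xb e)}" if "e \<in> edges G" for e
      proof -
        have "h ` {xa e, xb e} = {i * M + r (xa e), j * M + s (xb e)}"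
          using x(1,2)[OF that] hA hB by simp
        then show ?thesis
          using x(3)[OF that] by simp
      qed
      have h_in: "h ` e \<in> E" if "e \<in> edges G" for e
        using h_edge[OF that] edgeK[OF ij] r s x(1,2)[OF that] by simp
      obtain C where C: "copy_in C G K" "edges C = (`) h ` edges G"
      proof (rule copy_inI[OF assms(7) K_eog])
        have "inj_on h A" "inj_on h B"
          using r_inj s_inj hA hB by (auto simp: inj_on_def)
        moreover have "h a \<noteq> h b" if "a \<in> A" "b \<in> B" for a b
          using block_less[OF ij(1) r(2)[OF that(1)], of "s b"] hA[OF that(1)] hB[OF that(2)] by simp
        then have "h ` A \<inter> h ` B = {}"
          by blast
        ultimately show "inj_on h (verts G)"
          unfolding AB(1)[symmetric] inj_on_Un by blast
        show "h ` verts G \<subseteq> verts K"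
          using hA hB r s block ij by (auto simp: K_def AB(1)[symmetric])
        show "h ` e \<in> edges K" if "e \<in> edges G" for e
          using h_in[OF that] by (simp add: K_def)
        show "(h ` e, h ` e') \<in> edge_order K"
          if e: "e \<in> edges G" "e' \<in> edges G" "e \<noteq> e'" "(e, e') \<in> edge_order G" for e e'
        proof -
          \<comment> \<open>All edges of this copy join the same two blocks, so the first component
            is constant and the label \<open>f\<close> decides.\<close>
          have key_h: "key (h ` e) = (rkH {w i, w j}, f (r (xa e), s (xb e)), i * M + r (xa e), j * M + s (xb e))"
            if "e \<in> edges G" for e
            using h_edge[OF that] key_eq[OF ij(1)] r s x(1,2)[OF that] by simp
          have "f (r (xa e), s (xb e)) < f (r (xa e'), s (xb e'))"
            using incr[rule_format, OF eG_rkG(2)[OF e(2)] rkG[OF e]] eG_rkG(1) e by (simp add: p_def r_def s_def)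
          then have "key (h ` e) \<le> key (h ` e')"
            using key_h[OF e(1)] key_h[OF e(2)] by (simp add: less_eq_prod_def)
          then show ?thesis
            using h_in e(1,2) by (simp add: K_def)
        qed
      qed
      have "c (h ` e) = Blue" if "e \<in> edges G" for e
        using h_edge[OF that] blue[OF r(1) s(1)] x(1,2)[OF that] by (cases "c (h ` e)") auto
      with C(2) have "\<forall>e\<in>edges C. c e = Blue"
        by auto
      with C(1) show ?thesis
        by blast
    qed
  qed
  moreover have "0 < N"
    using M0 assms(3) by (simp add: N_def)
  ultimately have "edge_ordered_ramsey H G \<le> enat N"
    unfolding edge_ordered_ramsey_def using K by (intro INF_lower) blast
  then show ?thesis
    by (simp add: N_def M_def power2_eq_square mult.assoc)
qed

end
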